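(* Suppose $R_1$ and $R_2$ are inner McCoy rings. Then their direct product $R_1 \times R_2$ is also inner McCoy.
   Context: All rings are associative with unity. For a ring $A$, $A[x]$ denotes the polynomial ring in an indeterminate $x$ commuting with $A$. A ring $A$ is inner McCoy if for every pair $f(x), g(x) \in A[x]\setminus\{0\}$ with $f(x)g(x)f(x) = 0$ there exists $r \in A\setminus\{0\}$ such that $f(x)\, r\, f(x) = 0$. *)

theory Defs
  imports "HOL-Algebra.Chinese_Remainder" "HOL-Algebra.UnivPoly"
begin

text \<open>
  Rings are associative and unital, but need not be commutative; the zero ring is admitted.
  In \<open>UP A\<close> the indeterminate commutes with the coefficients.  An element \<open>r\<close> of \<open>A\<close>
  enters a product of polynomials as the constant polynomial \<open>monom (UP A) r 0\<close>.
\<close>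

definition inner_McCoy :: "('a, 'm) ring_scheme \<Rightarrow> bool" where
  "inner_McCoy A \<longleftrightarrow> ring A \<and>
    (\<forall>f \<in> carrier (UP A) - {\<zero>\<^bsub>UP A\<^esub>}. \<forall>g \<in> carrier (UP A) - {\<zero>\<^bsub>UP A\<^esub>}.
      f \<otimes>\<^bsub>UP A\<^esub> g \<otimes>\<^bsub>UP A\<^esub> f = \<zero>\<^bsub>UP A\<^esub> \<longrightarrow>
      (\<exists>r \<in> carrier A - {\<zero>\<^bsub>A\<^esub>}.
        f \<otimes>\<^bsub>UP A\<^esub> monom (UP A) r 0 \<otimes>\<^bsub>UP A\<^esub> f = \<zero>\<^bsub>UP A\<^esub>))"

end

theory Submission
  imports Defs
begin

text \<open>
  A ring homomorphism \<open>h\<close> acts coefficientwise on polynomials, by \<open>f \<mapsto> h \<circ> f\<close>, and this action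
  is compatible with products and constants.  A polynomial over \<open>R1 \<times> R2\<close> is therefore zero
  exactly when both its projections are.

  Let \<open>f g f = 0\<close> with \<open>g \<noteq> 0\<close> over \<open>R1 \<times> R2\<close>.  Some projection of \<open>g\<close>, say the first
  projection \<open>g1\<close>, is nonzero, and \<open>f1 g1 f1 = 0\<close>.  If \<open>f1 \<noteq> 0\<close>, the inner McCoy property
  of \<open>R1\<close> gives \<open>a \<noteq> 0\<close> with \<open>f1 a f1 = 0\<close>; if \<open>f1 = 0\<close>, any nonzero \<open>a\<close> does, for instance
  a nonzero coefficient of \<open>g1\<close>.  Then \<open>r = (a, 0)\<close> is the required element, because the second
  projection of \<open>f r f\<close> is \<open>f2 0 f2 = 0\<close>.  This argument is
  \<open>inner_McCoy_witness_from_factor\<close>, phrased for an arbitrary ring with two jointly faithful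
  projections so that it serves both factors.
\<close>

section \<open>Coefficientwise action of a ring homomorphism on polynomials\<close>

context ring_hom_ring
begin

lemma comp_in_carrier_UP:
  assumes "f \<in> carrier (UP R)"
  shows "h \<circ> f \<in> carrier (UP S)"
proof -
  have f: "f \<in> up R" using assms by (simp add: UP_def)
  then obtain n where "bound \<zero>\<^bsub>R\<^esub> n f" by auto
  then have "bound \<zero>\<^bsub>S\<^esub> n (h \<circ> f)" by (auto simp: bound_def)
  then have "h \<circ> f \<in> up S" using mem_upD[OF f] by (intro mem_upI) auto
  then show ?thesis by (simp add: UP_def)
qed

lemma comp_UP_mult:
  assumes "f \<in> carrier (UP R)" and "g \<in> carrier (UP R)"
  shows "h \<circ> (f \<otimes>\<^bsub>UP R\<^esub> g) = (h \<circ> f) \<otimes>\<^bsub>UP S\<^esub> (h \<circ> g)"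
proof -
  have fg: "f \<in> up R" "g \<in> up R" using assms by (simp_all add: UP_def)
  have hfg: "h \<circ> f \<in> up S" "h \<circ> g \<in> up S"
    using assms[THEN comp_in_carrier_UP] by (simp_all add: UP_def)
  have "h (\<Oplus>\<^bsub>R\<^esub>i\<in>{..n}. f i \<otimes>\<^bsub>R\<^esub> g (n - i)) = (\<Oplus>\<^bsub>S\<^esub>i\<in>{..n}. h (f i) \<otimes>\<^bsub>S\<^esub> h (g (n - i)))" for n
    using fg[THEN mem_upD] by (subst hom_finsum) (auto simp: comp_def)
  then show ?thesis using fg hfg by (auto simp: UP_def)
qed

lemma comp_UP_monom:
  assumes "a \<in> carrier R"
  shows "h \<circ> monom (UP R) a n = monom (UP S) (h a) n"
  using assms by (auto simp: UP_def)

lemma comp_UP_sandwich: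
  assumes "f \<in> carrier (UP R)" and "g \<in> carrier (UP R)"
  shows "h \<circ> (f \<otimes>\<^bsub>UP R\<^esub> g \<otimes>\<^bsub>UP R\<^esub> f) = (h \<circ> f) \<otimes>\<^bsub>UP S\<^esub> (h \<circ> g) \<otimes>\<^bsub>UP S\<^esub> (h \<circ> f)"
proof -
  interpret P: ring "UP R" using UP_ring.UP_ring[OF UP_ring.intro[OF R.ring_axioms]] .
  show ?thesis using assms by (simp add: comp_UP_mult)
qed

lemma comp_UP_zero: "h \<circ> \<zero>\<^bsub>UP R\<^esub> = \<zero>\<^bsub>UP S\<^esub>"
  by (auto simp: UP_def)

end

lemma UP_zero_of_jointly_faithful:
  assumes f: "f \<in> carrier (UP P)"
    and pf: "p \<circ> f = \<zero>\<^bsub>UP A\<^esub>" and qf: "q \<circ> f = \<zero>\<^bsub>UP B\<^esub>"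
    and faithful: "\<And>x. x \<in> carrier P \<Longrightarrow> p x = \<zero>\<^bsub>A\<^esub> \<Longrightarrow> q x = \<zero>\<^bsub>B\<^esub> \<Longrightarrow> x = \<zero>\<^bsub>P\<^esub>"
  shows "f = \<zero>\<^bsub>UP P\<^esub>"
proof -
  have "f i = \<zero>\<^bsub>P\<^esub>" for i
  proof (rule faithful)
    show "f i \<in> carrier P" using f by (auto simp: UP_def)
    show "p (f i) = \<zero>\<^bsub>A\<^esub>" "q (f i) = \<zero>\<^bsub>B\<^esub>"
      using fun_cong[OF pf, of i] fun_cong[OF qf, of i] by (simp_all add: UP_def)
  qed
  then show ?thesis by (auto simp: UP_def)
qed

section \<open>Inner McCoy witnesses\<close>

text \<open>
  A nonzero polynomial over a product can have projection \<open>0\<close>, so the property of a factor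
  has to be extended to \<open>f = 0\<close>, where every nonzero coefficient of \<open>g\<close> is a witness.
\<close>

lemma inner_McCoy_witness:
  assumes A: "inner_McCoy A"
    and f: "f \<in> carrier (UP A)" and g: "g \<in> carrier (UP A)" and g0: "g \<noteq> \<zero>\<^bsub>UP A\<^esub>"
    and fgf: "f \<otimes>\<^bsub>UP A\<^esub> g \<otimes>\<^bsub>UP A\<^esub> f = \<zero>\<^bsub>UP A\<^esub>"
  shows "\<exists>a \<in> carrier A - {\<zero>\<^bsub>A\<^esub>}. f \<otimes>\<^bsub>UP A\<^esub> monom (UP A) a 0 \<otimes>\<^bsub>UP A\<^esub> f = \<zero>\<^bsub>UP A\<^esub>"
proof (cases "f = \<zero>\<^bsub>UP A\<^esub>")
  case True
  have "ring A" using A by (simp add: inner_McCoy_def)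
  then interpret UP_ring A "UP A" by (simp_all add: UP_ring.intro)
  from g0 obtain i where "g i \<noteq> \<zero>\<^bsub>A\<^esub>" by (auto simp: UP_def)
  moreover have "g i \<in> carrier A" using g by (auto simp: UP_def)
  ultimately show ?thesis using True by (intro bexI[of _ "g i"]) simp_all
next
  case False
  then show ?thesis using A f g g0 fgf unfolding inner_McCoy_def by blast
qed

text \<open>
  The map \<open>s\<close> stands for the inclusion of the factor \<open>A\<close>, and lifts a witness over \<open>A\<close>
  to one over \<open>P\<close>: it is a section of \<open>p\<close>, and \<open>q\<close> kills its values.
\<close>

lemma inner_McCoy_witness_from_factor:
  assumes p: "ring_hom_ring P A p" and q: "ring_hom_ring P B q"
    and faithful: "\<And>x. x \<in> carrier P \<Longrightarrow> p x = \<zero>\<^bsub>A\<^esub> \<Longrightarrow> q x = \<zero>\<^bsub>B\<^esub> \<Longrightarrow> x = \<zero>\<^bsub>P\<^esub>"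
    and s: "\<And>a. a \<in> carrier A \<Longrightarrow> s a \<in> carrier P \<and> p (s a) = a \<and> q (s a) = \<zero>\<^bsub>B\<^esub>"
    and A: "inner_McCoy A"
    and f: "f \<in> carrier (UP P)" and g: "g \<in> carrier (UP P)"
    and fgf: "f \<otimes>\<^bsub>UP P\<^esub> g \<otimes>\<^bsub>UP P\<^esub> f = \<zero>\<^bsub>UP P\<^esub>"
    and pg: "p \<circ> g \<noteq> \<zero>\<^bsub>UP A\<^esub>"
  shows "\<exists>r \<in> carrier P - {\<zero>\<^bsub>P\<^esub>}. f \<otimes>\<^bsub>UP P\<^esub> monom (UP P) r 0 \<otimes>\<^bsub>UP P\<^esub> f = \<zero>\<^bsub>UP P\<^esub>"
proof -
  interpret p: ring_hom_ring P A p by (rule p)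
  interpret q: ring_hom_ring P B q by (rule q)
  interpret UPP: UP_ring P "UP P" by (simp_all add: UP_ring.intro p.R.ring_axioms)
  interpret UPB: UP_ring B "UP B" by (simp_all add: UP_ring.intro q.S.ring_axioms)
  have "(p \<circ> f) \<otimes>\<^bsub>UP A\<^esub> (p \<circ> g) \<otimes>\<^bsub>UP A\<^esub> (p \<circ> f) = \<zero>\<^bsub>UP A\<^esub>"
    using p.comp_UP_sandwich[OF f g] fgf p.comp_UP_zero by simp
  then obtain a where a: "a \<in> carrier A" "a \<noteq> \<zero>\<^bsub>A\<^esub>"
    and faf: "(p \<circ> f) \<otimes>\<^bsub>UP A\<^esub> monom (UP A) a 0 \<otimes>\<^bsub>UP A\<^esub> (p \<circ> f) = \<zero>\<^bsub>UP A\<^esub>"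
    using inner_McCoy_witness[OF A p.comp_in_carrier_UP[OF f] p.comp_in_carrier_UP[OF g] pg]
    by auto
  let ?r = "monom (UP P) (s a) 0"
  have r: "?r \<in> carrier (UP P)" using s a by simp
  have "f \<otimes>\<^bsub>UP P\<^esub> ?r \<otimes>\<^bsub>UP P\<^esub> f = \<zero>\<^bsub>UP P\<^esub>"
  proof (rule UP_zero_of_jointly_faithful[OF _ _ _ faithful])
    show "f \<otimes>\<^bsub>UP P\<^esub> ?r \<otimes>\<^bsub>UP P\<^esub> f \<in> carrier (UP P)" using f r by simp
    show "p \<circ> (f \<otimes>\<^bsub>UP P\<^esub> ?r \<otimes>\<^bsub>UP P\<^esub> f) = \<zero>\<^bsub>UP A\<^esub>"
      using p.comp_UP_sandwich[OF f r] s a faf by (simp add: p.comp_UP_monom)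
    show "q \<circ> (f \<otimes>\<^bsub>UP P\<^esub> ?r \<otimes>\<^bsub>UP P\<^esub> f) = \<zero>\<^bsub>UP B\<^esub>"
      using q.comp_UP_sandwich[OF f r] s a q.comp_in_carrier_UP[OF f]
      by (simp add: q.comp_UP_monom)
  qed
  moreover have "s a \<noteq> \<zero>\<^bsub>P\<^esub>" using s[OF a(1)] a(2) p.hom_zero by auto
  ultimately show ?thesis using s a(1) by blast
qed

section \<open>Direct products\<close>

lemma RDirProd_zero: "\<zero>\<^bsub>RDirProd R S\<^esub> = (\<zero>\<^bsub>R\<^esub>, \<zero>\<^bsub>S\<^esub>)"
  by (simp add: RDirProd_def DirProd_def monoid.defs)

lemma
  assumes "ring R" and "ring S"
  shows fst_ring_hom_RDirProd: "ring_hom_ring (RDirProd R S) R fst"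
    and snd_ring_hom_RDirProd: "ring_hom_ring (RDirProd R S) S snd"
proof -
  have "fst \<in> ring_hom (RDirProd R S) R" "snd \<in> ring_hom (RDirProd R S) S"
    by (auto simp: ring_hom_def RDirProd_def DirProd_def monoid.defs)
  then show "ring_hom_ring (RDirProd R S) R fst" "ring_hom_ring (RDirProd R S) S snd"
    using assms RDirProd_ring[OF assms] by (simp_all add: ring_hom_ringI2)
qed

theorem theorem5p5:
  fixes R1 :: "('a, 'm) ring_scheme" and R2 :: "('b, 'n) ring_scheme"
  assumes "inner_McCoy R1" and "inner_McCoy R2"
  shows "inner_McCoy (RDirProd R1 R2)"
proof -
  let ?P = "RDirProd R1 R2"
  have R: "ring R1" "ring R2" using assms by (simp_all add: inner_McCoy_def)
  interpret R1: ring R1 by (rule R)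
  interpret R2: ring R2 by (rule R)
  note homs = fst_ring_hom_RDirProd[OF R] snd_ring_hom_RDirProd[OF R]
  have "\<exists>r \<in> carrier ?P - {\<zero>\<^bsub>?P\<^esub>}. f \<otimes>\<^bsub>UP ?P\<^esub> monom (UP ?P) r 0 \<otimes>\<^bsub>UP ?P\<^esub> f = \<zero>\<^bsub>UP ?P\<^esub>"
    if f: "f \<in> carrier (UP ?P)" and g: "g \<in> carrier (UP ?P)" and g0: "g \<noteq> \<zero>\<^bsub>UP ?P\<^esub>"
      and fgf: "f \<otimes>\<^bsub>UP ?P\<^esub> g \<otimes>\<^bsub>UP ?P\<^esub> f = \<zero>\<^bsub>UP ?P\<^esub>" for f g
  proof -
    consider "fst \<circ> g \<noteq> \<zero>\<^bsub>UP R1\<^esub>" | "snd \<circ> g \<noteq> \<zero>\<^bsub>UP R2\<^esub>"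
      using UP_zero_of_jointly_faithful[OF g, of fst R1 snd R2] g0
      by (fastforce simp: RDirProd_zero)
    then show ?thesis
    proof cases
      case 1
      show ?thesis
        by (rule inner_McCoy_witness_from_factor[where s = "\<lambda>a. (a, \<zero>\<^bsub>R2\<^esub>)",
              OF homs _ _ assms(1) f g fgf 1])
          (auto simp: RDirProd_zero RDirProd_carrier)
    next
      case 2
      show ?thesis
        by (rule inner_McCoy_witness_from_factor[where s = "\<lambda>b. (\<zero>\<^bsub>R1\<^esub>, b)",
              OF homs(2,1) _ _ assms(2) f g fgf 2])
          (auto simp: RDirProd_zero RDirProd_carrier)
    qed
  qed
  then show ?thesis using RDirProd_ring[OF R] unfolding inner_McCoy_def by blast
qed

end
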